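(* Let $A$ be an $n\times n$ matrix with entries in $\{0,1\}$, let $\{\rho_{ij}\}_{1\le i,j\le n}$ be independent random $d\times d$ complex matrices, all drawn from the Haar measure or all from the Gaussian measure, and let $M$ be the $n\times n$ matrix with entries $M_{ij}=\rho_{ij}A_{ij}$. Define \[ X=\lvert\operatorname{tr}\det M\rvert^2,\quad X_s=\lvert\operatorname{tr}\operatorname{sdet}M\rvert^2,\quad X_{\rm Frob}=\lVert\det M\rVert^2,\quad X_{{\rm Frob},s}=\lVert\operatorname{sdet}M\rVert^2. \] Then \[ \frac{1}{d^4}\,\frac{\mathbb{E}[X^2]}{\mathbb{E}[X]^2}\le\frac{\mathbb{E}[X_{\rm Frob}^2]}{\mathbb{E}[X_{\rm Frob}]^2}\le d^4\,\frac{\mathbb{E}[X^2]}{\mathbb{E}[X]^2}, \] and similarly \[ \frac{1}{d^4}\,\frac{\mathbb{E}[X_s^2]}{\mathbb{E}[X_s]^2}\le\frac{\mathbb{E}[X_{{\rm Frob},s}^2]}{\mathbb{E}[X_{{\rm Frob},s}]^2}\le d^4\,\frac{\mathbb{E}[X_s^2]}{\mathbb{E}[X_s]^2}. \]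
   Context: The Haar measure is the uniform (Haar) probability distribution on the unitary group $\mathsf{U}(d)$. In the Gaussian measure, each entry of the $d\times d$ matrix is drawn independently from the complex Gaussian distribution with mean $0$ and variance $1/d$ (real and imaginary parts independent real Gaussians with mean $0$ and variance $1/(2d)$). For an $n\times n$ matrix $M$ with $d\times d$ complex matrix entries, $\det M=\sum_{\alpha\in S_n}(-1)^{\alpha}\prod_{i=1}^n M_{i,\alpha i}$ and $\operatorname{sdet}M=\frac{1}{n!}\sum_{\alpha,\alpha'\in S_n}(-1)^{\alpha'\alpha^{-1}}\prod_{i=1}^n M_{\alpha i,\alpha' i}$, where $(-1)^\pi$ is the sign of $\pi$ and products are taken in the order $i=1,\dots,n$ (left to right). $\operatorname{tr}$ is the matrix trace and $\lVert Q\rVert^2=\operatorname{tr}(QQ^\dagger)$ is the squared Frobenius norm. *)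

theory Defs
  imports "HOL-Probability.Probability" "HOL-Combinatorics.Permutations"
begin

definition dagger :: "complex^'n^'m \<Rightarrow> complex^'m^'n" where
  "dagger Q = (\<chi> i j. cnj (Q $ j $ i))"

definition frob_norm_sq :: "complex^'d^'d \<Rightarrow> real" where
  "frob_norm_sq Q = Re (trace (Q ** dagger Q))"

definition unitary_group :: "(complex^'d^'d) set" where
  "unitary_group = {U. U ** dagger U = mat 1 \<and> dagger U ** U = mat 1}"

text \<open>
  A Haar measure is a left-invariant Borel probability measure on the unitary group, regarded
  here as a measure on the ambient matrix space that is concentrated on the group.
  Since the group is compact, exactly one such measure exists, and it is also right-invariant.
\<close>

definition is_haar_unitary :: "(complex^'d^'d) measure \<Rightarrow> bool" where
  "is_haar_unitary \<mu> \<longleftrightarrow>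
     prob_space \<mu> \<and> sets \<mu> = sets borel \<and> (AE U in \<mu>. U \<in> unitary_group) \<and>
     (\<forall>U\<in>unitary_group. distr \<mu> borel (\<lambda>V. U ** V) = \<mu>)"

text \<open>
  Joint law of \<open>2 d\<^sup>2\<close> independent real Gaussians of mean \<open>0\<close> and variance \<open>1 / (2 d)\<close>:
  coordinate \<open>(i, j, True)\<close> is the real part and \<open>(i, j, False)\<close> the imaginary part of
  entry \<open>(i, j)\<close>. The second argument of \<open>normal_density\<close> is the standard deviation.
\<close>

definition gaussian_matrix_measure :: "(complex^'d^'d) measure" where
  "gaussian_matrix_measure =
     distr
       (\<Pi>\<^sub>M k\<in>(UNIV :: ('d \<times> 'd \<times> bool) set).
          density lborel (normal_density 0 (sqrt (1 / (2 * real CARD('d))))))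
       borel
       (\<lambda>x. \<chi> i j. Complex (x (i, j, True)) (x (i, j, False)))"

text \<open>
  The product \<open>f 1 ** f 2 ** \<dots> ** f n\<close>, in this order. The type class multiplication
  on vectors is componentwise, so the generic product operators do not apply.
\<close>

definition ordered_prod :: "nat \<Rightarrow> (nat \<Rightarrow> complex^'d^'d) \<Rightarrow> complex^'d^'d" where
  "ordered_prod n f = foldr (**) (map f [1..<Suc n]) (mat 1)"

definition nc_det :: "nat \<Rightarrow> (nat \<Rightarrow> nat \<Rightarrow> complex^'d^'d) \<Rightarrow> complex^'d^'d" where
  "nc_det n M =
     (\<Sum>\<alpha> | \<alpha> permutes {1..n}. of_int (sign \<alpha>) *\<^sub>R ordered_prod n (\<lambda>i. M i (\<alpha> i)))"

definition nc_sdet :: "nat \<Rightarrow> (nat \<Rightarrow> nat \<Rightarrow> complex^'d^'d) \<Rightarrow> complex^'d^'d" where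
  "nc_sdet n M =
     (1 / fact n) *\<^sub>R
     (\<Sum>\<alpha> | \<alpha> permutes {1..n}. \<Sum>\<alpha>' | \<alpha>' permutes {1..n}.
        of_int (sign (\<alpha>' \<circ> inv \<alpha>)) *\<^sub>R ordered_prod n (\<lambda>i. M (\<alpha> i) (\<alpha>' i)))"

end

theory Submission
  imports Defs
begin

text \<open>
  Let \<open>S\<close> be the determinant or the symmetrized determinant and \<open>U\<close> a unitary matrix. Multiplying
  one row of \<open>M\<close> by \<open>U\<close> from the left does not change its law. For the determinant,
  \<open>tr (U S)\<close> is the trace of the determinant after this operation on the first row; for the symmetrized
  determinant, cyclicity of the trace shows that \<open>tr (U S)\<close> is the average, over the rows \<open>i\<close>, of the
  traces obtained by operating on row \<open>i\<close>. By convexity the second and fourth moments of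
  \<open>|tr (U S)|\<close> are at most those of \<open>|tr S|\<close>. The average of \<open>|tr (U S)|\<^sup>2\<close> over the finitely many
  signed permutation matrices \<open>U\<close> is \<open>\<parallel>S\<parallel>\<^sup>2 / d\<close>, whence \<open>E \<parallel>S\<parallel>\<^sup>2 \<le> d E |tr S|\<^sup>2\<close> and
  \<open>E \<parallel>S\<parallel>\<^sup>4 \<le> d\<^sup>2 E |tr S|\<^sup>4\<close>. Together with the pointwise bound \<open>|tr S|\<^sup>2 \<le> d \<parallel>S\<parallel>\<^sup>2\<close> this gives
  all four inequalities. Using signed permutations only, invariance of the Gaussian measure reduces to
  permuting and reflecting independent coordinates.
\<close>

section \<open>Signed permutation matrices as a unitary 1-design\<close>

definition signed_perm_matrix :: "('d \<Rightarrow> 'd) \<Rightarrow> ('d \<Rightarrow> bool) \<Rightarrow> complex^'d^'d" where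
  "signed_perm_matrix \<sigma> s = (\<chi> i j. if j = \<sigma> i then (if s i then 1 else -1) else 0)"

lemma signed_perm_matrix_mult_nth:
  "(signed_perm_matrix \<sigma> s ** V) $ i $ j = (if s i then 1 else -1) * V $ \<sigma> i $ j"
  by (simp add: signed_perm_matrix_def matrix_matrix_mult_def if_distrib[where f = "\<lambda>x. x * _"]
      sum.delta' cong: if_cong)

lemma signed_perm_matrix_unitary:
  fixes \<sigma> :: "'d::finite \<Rightarrow> 'd"
  assumes "inj \<sigma>"
  shows "signed_perm_matrix \<sigma> s \<in> unitary_group"
proof -
  have "signed_perm_matrix \<sigma> s ** dagger (signed_perm_matrix \<sigma> s) = mat 1"
    using assms
    by (simp add: vec_eq_iff signed_perm_matrix_mult_nth mat_def dagger_def)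
       (auto simp: signed_perm_matrix_def inj_eq)
  then show ?thesis
    using matrix_left_right_inverse[where ?'a = complex] by (auto simp: unitary_group_def)
qed

lemma trace_signed_perm_matrix_mult:
  "trace (signed_perm_matrix \<sigma> s ** V) = (\<Sum>i\<in>UNIV. (if s i then 1 else -1) * V $ \<sigma> i $ i)"
  by (simp add: trace_def signed_perm_matrix_mult_nth)

lemma frob_norm_sq_eq_sum: "frob_norm_sq V = (\<Sum>i\<in>UNIV. \<Sum>j\<in>UNIV. (cmod (V $ i $ j))\<^sup>2)"
  by (simp add: frob_norm_sq_def trace_def matrix_matrix_mult_def dagger_def complex_mult_cnj cmod_power2)

lemma frob_norm_sq_nonneg: "0 \<le> frob_norm_sq V"
  by (simp add: frob_norm_sq_eq_sum sum_nonneg)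

text \<open>Cauchy-Schwarz over the diagonal entries, whose squared moduli are among the terms of
  the Frobenius sum.\<close>

lemma cmod_trace_sq_le:
  fixes V :: "complex^'d^'d"
  shows "(cmod (trace V))\<^sup>2 \<le> real CARD('d) * frob_norm_sq V"
proof -
  have "(cmod (trace V))\<^sup>2 \<le> (\<Sum>i\<in>UNIV. cmod (V $ i $ i))\<^sup>2"
    unfolding trace_def by (intro power_mono norm_sum) auto
  also have "\<dots> \<le> (\<Sum>i\<in>UNIV. (cmod (V $ i $ i))\<^sup>2) * real CARD('d)"
    by (rule sum_squared_le_sum_of_squares)
  also have "\<dots> \<le> frob_norm_sq V * real CARD('d)"
    unfolding frob_norm_sq_eq_sum
    by (intro mult_right_mono sum_mono order.trans[OF _ member_le_sum[where f = "\<lambda>j. (cmod (V $ _ $ j))\<^sup>2"]]) auto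
  finally show ?thesis by (simp add: mult.commute)
qed

text \<open>Over uniformly random signs, the product of the signs at two different indices averages
  to 0, so only the diagonal terms survive when the squared modulus is expanded.\<close>

lemma sum_over_signs_cmod_sq:
  fixes z :: "'d::finite \<Rightarrow> complex"
  shows "(\<Sum>s\<in>UNIV. (cmod (\<Sum>i\<in>UNIV. (if s i then 1 else -1) * z i))\<^sup>2)
    = 2 ^ CARD('d) * (\<Sum>i\<in>UNIV. (cmod (z i))\<^sup>2)"
proof -
  define e :: "('d \<Rightarrow> bool) \<Rightarrow> 'd \<Rightarrow> complex" where "e = (\<lambda>s i. if s i then 1 else -1)"
  have cnj_e: "cnj (e s i) = e s i" for s i by (simp add: e_def)
  have orth: "(\<Sum>s\<in>UNIV. e s i * e s j) = (if i = j then 2 ^ CARD('d) else 0)" for i j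
  proof (cases "i = j")
    case True
    have "e s i * e s i = 1" for s by (simp add: e_def)
    then show ?thesis using True by (simp add: card_fun)
  next
    case False
    \<comment> \<open>Flipping the sign at \<open>i\<close> negates the sum.\<close>
    have "bij (\<lambda>s::'d \<Rightarrow> bool. s(i := \<not> s i))"
      by (rule o_bij[where g = "\<lambda>s::'d \<Rightarrow> bool. s(i := \<not> s i)"]) (auto simp: fun_eq_iff)
    then have "(\<Sum>s\<in>UNIV. e s i * e s j) = (\<Sum>s\<in>UNIV. e (s(i := \<not> s i)) i * e (s(i := \<not> s i)) j)"
      by (intro sum.reindex_bij_betw[symmetric])
    also have "\<dots> = - (\<Sum>s\<in>UNIV. e s i * e s j)"
      unfolding sum_negf[symmetric] using False by (intro sum.cong) (auto simp: e_def)
    finally show ?thesis using False by simp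
  qed
  \<comment> \<open>The expansion takes place in the complex numbers, where the squared modulus of
    \<open>w\<close> is \<open>w * cnj w\<close>.\<close>
  have "complex_of_real (\<Sum>s\<in>UNIV. (cmod (\<Sum>i\<in>UNIV. e s i * z i))\<^sup>2)
      = (\<Sum>s\<in>UNIV. \<Sum>i\<in>UNIV. \<Sum>j\<in>UNIV. (e s i * e s j) * (z i * cnj (z j)))"
    by (simp only: of_real_sum complex_norm_square cnj_sum complex_cnj_mult cnj_e sum_product)
       (simp add: mult_ac)
  also have "\<dots> = (\<Sum>i\<in>UNIV. \<Sum>j\<in>UNIV. \<Sum>s\<in>UNIV. (e s i * e s j) * (z i * cnj (z j)))"
    by (subst sum.swap, subst (2) sum.swap) rule
  also have "\<dots> = (\<Sum>i\<in>UNIV. \<Sum>j\<in>UNIV. (if i = j then 2 ^ CARD('d) else 0) * (z i * cnj (z j)))"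
    by (simp only: sum_distrib_right[symmetric] orth)
  also have "\<dots> = 2 ^ CARD('d) * (\<Sum>i\<in>UNIV. z i * cnj (z i))"
    by (simp add: if_distrib[where f = "\<lambda>x. x * _"] sum.delta sum_distrib_left cong: if_cong)
  also have "\<dots> = complex_of_real (2 ^ CARD('d) * (\<Sum>i\<in>UNIV. (cmod (z i))\<^sup>2))"
    unfolding of_real_mult of_real_sum complex_norm_square by simp
  finally show ?thesis unfolding e_def using of_real_eq_iff by blast
qed

text \<open>A uniformly random permutation sends \<open>i\<close> to a uniformly random index.
  Instead of counting permutations with a prescribed value, the proof spreads
  \<open>CARD('d)\<close> equal copies of the sum over all positions \<open>k\<close> and sums over
  \<open>k\<close> first.\<close>

lemma sum_over_permutations_apply:
  fixes g :: "'d::finite \<Rightarrow> real"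
  shows "real CARD('d) * (\<Sum>\<sigma> | \<sigma> permutes UNIV. g (\<sigma> i)) = fact CARD('d) * (\<Sum>j\<in>UNIV. g j)"
proof -
  \<comment> \<open>Composing with the transposition of \<open>i\<close> and \<open>k\<close>
    permutes the permutations.\<close>
  have *: "(\<Sum>\<sigma> | \<sigma> permutes UNIV. g (\<sigma> k)) = (\<Sum>\<sigma> | \<sigma> permutes UNIV. g (\<sigma> i))" for k
    using sum_permutations_compose_right[OF permutes_swap_id[OF UNIV_I UNIV_I], of "\<lambda>\<sigma>. g (\<sigma> i)" i k]
    by simp
  have "real CARD('d) * (\<Sum>\<sigma> | \<sigma> permutes UNIV. g (\<sigma> i)) = (\<Sum>k::'d\<in>UNIV. \<Sum>\<sigma> | \<sigma> permutes UNIV. g (\<sigma> i))"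
    by simp
  also have "\<dots> = (\<Sum>k\<in>UNIV. \<Sum>\<sigma> | \<sigma> permutes UNIV. g (\<sigma> k))"
    by (intro sum.cong refl *[symmetric])
  also have "\<dots> = (\<Sum>\<sigma> | \<sigma> permutes UNIV. \<Sum>k\<in>UNIV. g (\<sigma> k))"
    by (rule sum.swap)
  also have "\<dots> = (\<Sum>\<sigma> | \<sigma> permutes (UNIV :: 'd set). \<Sum>j\<in>UNIV. g j)"
    by (rule sum.cong[OF refl], rule sum.permute[of _ UNIV g, unfolded o_def, symmetric]) simp
  also have "\<dots> = fact CARD('d) * (\<Sum>j\<in>UNIV. g j)"
    by (simp add: card_permutations[of UNIV "CARD('d)"])
  finally show ?thesis .
qed

definition signed_perm_index :: "(('d \<Rightarrow> 'd) \<times> ('d \<Rightarrow> bool)) set" where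
  "signed_perm_index = {\<sigma>. \<sigma> permutes UNIV} \<times> UNIV"

lemma finite_signed_perm_index: "finite (signed_perm_index :: (('d::finite \<Rightarrow> 'd) \<times> _) set)"
  by (simp add: signed_perm_index_def finite_permutations)

lemma card_signed_perm_index:
  "card (signed_perm_index :: (('d::finite \<Rightarrow> 'd) \<times> _) set) = fact CARD('d) * 2 ^ CARD('d)"
  by (simp add: signed_perm_index_def card_cartesian_product card_fun card_permutations[of UNIV "CARD('d)"])

text \<open>The signed permutation matrices form a unitary 1-design.\<close>

lemma frob_norm_sq_eq_average:
  fixes V :: "complex^'d^'d"
  shows "real (card (signed_perm_index :: (('d \<Rightarrow> 'd) \<times> _) set)) * frob_norm_sq V =
    real CARD('d) * (\<Sum>(\<sigma>, s)\<in>signed_perm_index. (cmod (trace (signed_perm_matrix \<sigma> s ** V)))\<^sup>2)"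
proof -
  have "real CARD('d) * (\<Sum>(\<sigma>, s)\<in>signed_perm_index. (cmod (trace (signed_perm_matrix \<sigma> s ** V)))\<^sup>2)
     = real CARD('d) * (\<Sum>\<sigma> | \<sigma> permutes UNIV. 2 ^ CARD('d) * (\<Sum>i\<in>UNIV. (cmod (V $ \<sigma> i $ i))\<^sup>2))"
    unfolding signed_perm_index_def
    by (simp only: sum.cartesian_product[symmetric] trace_signed_perm_matrix_mult sum_over_signs_cmod_sq)
  also have "\<dots> = 2 ^ CARD('d) * (\<Sum>i\<in>UNIV. real CARD('d) * (\<Sum>\<sigma> | \<sigma> permutes UNIV. (cmod (V $ \<sigma> i $ i))\<^sup>2))"
    unfolding sum_distrib_left by (subst sum.swap) (simp add: mult_ac)
  \<comment> \<open>The signs have removed the cross terms; averaging over \<open>\<sigma>\<close>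
    now replaces the one entry of column \<open>i\<close> in row \<open>\<sigma> i\<close> by the
    whole column.\<close>
  also have "\<dots> = 2 ^ CARD('d) * (\<Sum>i\<in>UNIV. fact CARD('d) * (\<Sum>j\<in>UNIV. (cmod (V $ j $ i))\<^sup>2))"
    by (simp only: sum_over_permutations_apply[where g = "\<lambda>j. (cmod (V $ j $ _))\<^sup>2"])
  also have "\<dots> = 2 ^ CARD('d) * fact CARD('d) * frob_norm_sq V"
    unfolding frob_norm_sq_eq_sum by (subst sum.swap) (simp add: sum_distrib_left mult_ac)
  finally show ?thesis by (simp add: card_signed_perm_index mult_ac)
qed

section \<open>Multiplying one row by a matrix\<close>

definition mult_row :: "nat \<Rightarrow> complex^'d^'d \<Rightarrow> (nat \<Rightarrow> nat \<Rightarrow> complex^'d^'d) \<Rightarrow> nat \<Rightarrow> nat \<Rightarrow> complex^'d^'d"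
  where "mult_row i U M = (\<lambda>k l. if k = i then U ** M k l else M k l)"

text \<open>Lists can be cut and reassembled with \<open>@\<close>, which suits the cyclic rotation
  of a product.\<close>

definition mat_list_prod :: "(complex^'d^'d) list \<Rightarrow> complex^'d^'d" where
  "mat_list_prod xs = foldr (**) xs (mat 1)"

lemma mat_list_prod_simps [simp]:
  "mat_list_prod [] = mat 1"
  "mat_list_prod (x # xs) = x ** mat_list_prod xs"
  by (simp_all add: mat_list_prod_def)

lemma mat_list_prod_append: "mat_list_prod (xs @ ys) = mat_list_prod xs ** mat_list_prod ys"
  by (induction xs) (simp_all add: matrix_mul_assoc)

lemma ordered_prod_eq: "ordered_prod n f = mat_list_prod (map f [1..<Suc n])"
  by (simp add: ordered_prod_def mat_list_prod_def)

lemma ordered_prod_cong: "(\<And>i. i \<in> {1..n} \<Longrightarrow> f i = g i) \<Longrightarrow> ordered_prod n f = ordered_prod n g"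
  unfolding ordered_prod_eq by (intro arg_cong[where f = mat_list_prod] map_cong) auto

lemma mat_mult_scaleR_right: "U ** (c *\<^sub>R (V :: complex^'d^'d)) = c *\<^sub>R (U ** V)"
  by (simp add: vec_eq_iff matrix_matrix_mult_def scaleR_sum_right)

lemma mat_mult_sum_right: "U ** (\<Sum>a\<in>S. V a :: complex^'d^'d) = (\<Sum>a\<in>S. U ** V a)"
  by (induction S rule: infinite_finite_induct) (simp_all add: matrix_add_ldistrib)

lemma trace_scaleR: "trace (c *\<^sub>R (V :: complex^'d^'d)) = c *\<^sub>R trace V"
  by (simp add: trace_def scaleR_sum_right)

lemma trace_sum: "trace (\<Sum>a\<in>S. V a :: complex^'d^'d) = (\<Sum>a\<in>S. trace (V a))"
  unfolding trace_def by (simp add: sum.swap[of _ _ S])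

text \<open>Each ordered product begins with its factor from row 1, which absorbs \<open>U\<close>
  by associativity. The bound on \<open>n\<close> guarantees that this factor is present.\<close>

lemma nc_det_mult_row:
  assumes "1 \<le> n"
  shows "U ** nc_det n M = nc_det n (mult_row 1 U M)"
proof -
  have upt: "[1..<Suc n] = 1 # [2..<Suc n]"
    using assms by (simp add: upt_conv_Cons numeral_2_eq_2 del: upt_Suc)
  have "U ** ordered_prod n (\<lambda>i. M i (\<alpha> i)) = ordered_prod n (\<lambda>i. mult_row 1 U M i (\<alpha> i))" for \<alpha>
  proof -
    have "map (\<lambda>i. mult_row 1 U M i (\<alpha> i)) [2..<Suc n] = map (\<lambda>i. M i (\<alpha> i)) [2..<Suc n]"
      by (rule map_cong) (auto simp: mult_row_def)
    then show ?thesis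
      by (simp only: ordered_prod_eq upt list.map mat_list_prod_simps)
         (simp only: mult_row_def simp_thms if_True matrix_mul_assoc)
  qed
  then show ?thesis
    by (simp add: nc_det_def mat_mult_sum_right mat_mult_scaleR_right)
qed

text \<open>The cyclic shift of \<open>{1..n}\<close> that starts at \<open>m\<close>, written for
  indices from 1; it is the identity elsewhere, as \<open>permutes\<close> demands.\<close>

definition rot :: "nat \<Rightarrow> nat \<Rightarrow> nat \<Rightarrow> nat" where
  "rot n m k = (if k \<in> {1..n} then if k + m \<le> Suc n then k + m - 1 else k + m - 1 - n else k)"

text \<open>Taking sets shows that the shift is onto \<open>{1..n}\<close>, hence a permutation;
  mapping a function over both sides gives the rotated product.\<close>

lemma map_rot:
  assumes "m \<in> {1..n}"
  shows "map (rot n m) [1..<Suc n] = [m..<Suc n] @ [1..<m]"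
proof (rule nth_equalityI)
  show "length (map (rot n m) [1..<Suc n]) = length ([m..<Suc n] @ [1..<m])"
    using assms by (simp del: upt_Suc)
  fix i assume "i < length (map (rot n m) [1..<Suc n])"
  then have "i < n" by (simp del: upt_Suc)
  then show "map (rot n m) [1..<Suc n] ! i = ([m..<Suc n] @ [1..<m]) ! i"
    using assms by (auto simp: nth_append rot_def simp del: upt_Suc)
qed

lemma rot_permutes:
  assumes "m \<in> {1..n}"
  shows "rot n m permutes {1..n}"
proof (rule bij_imp_permutes)
  have "rot n m ` {1..n} = {1..n}"
    using arg_cong[OF map_rot[OF assms], of set] assms
    by (simp add: atLeastLessThanSuc_atLeastAtMost del: upt_Suc) auto
  then show "bij_betw (rot n m) {1..n} {1..n}"
    by (simp add: bij_betw_def eq_card_imp_inj_on)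
qed (auto simp: rot_def)

text \<open>Cyclicity carries the factors before position \<open>m\<close> to the end, so that the
  product begins with \<open>U ** f m\<close> and continues in the order of
  \<open>rot n m\<close>.\<close>

lemma trace_ordered_prod_mult_at:
  assumes "m \<in> {1..n}"
  shows "trace (ordered_prod n (\<lambda>k. if k = m then U ** f k else f k)) = trace (U ** ordered_prod n (f \<circ> rot n m))"
proof -
  let ?g = "\<lambda>k. if k = m then U ** f k else f k"
  have split: "[m..<Suc n] = m # [Suc m..<Suc n]" "[1..<Suc n] = [1..<m] @ [m..<Suc n]"
    using assms upt_add_eq_append[of 1 m "Suc n - m"] by (auto simp: upt_conv_Cons simp del: upt_Suc)
  have "map ?g [1..<Suc n] = map f [1..<m] @ (U ** f m) # map f [Suc m..<Suc n]"
    unfolding split by auto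
  then have "trace (ordered_prod n ?g) =
      trace (mat_list_prod (map f [1..<m]) ** (U ** mat_list_prod (map f [m..<Suc n])))"
    by (simp add: ordered_prod_eq mat_list_prod_append split(1) matrix_mul_assoc del: upt_Suc)
  also have "\<dots> = trace (U ** mat_list_prod (map f ([m..<Suc n] @ [1..<m])))"
    by (subst trace_mul_sym) (simp add: mat_list_prod_append matrix_mul_assoc del: upt_Suc)
  also have "map f ([m..<Suc n] @ [1..<m]) = map (f \<circ> rot n m) [1..<Suc n]"
    unfolding map_rot[OF assms, symmetric] by simp
  finally show ?thesis by (simp add: ordered_prod_eq)
qed

text \<open>
  By cyclicity of the trace, inserting \<open>U\<close> in front of the factor taken from row \<open>i\<close> amounts to
  starting the product at that factor; summing over \<open>i\<close> recovers every starting point.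
\<close>

lemma sum_trace_nc_sdet_mult_row:
  "(\<Sum>i\<in>{1..n}. trace (nc_sdet n (mult_row i U M))) = of_nat n * trace (U ** nc_sdet n M)"
proof -
  let ?P = "{\<alpha>. \<alpha> permutes {1..n}}"
  define s :: "(nat \<Rightarrow> nat) \<Rightarrow> (nat \<Rightarrow> nat) \<Rightarrow> real" where "s = (\<lambda>\<alpha> \<alpha>'. of_int (sign (\<alpha>' \<circ> inv \<alpha>)))"
  define F where "F = (\<lambda>\<alpha> \<alpha>' :: nat \<Rightarrow> nat. trace (U ** ordered_prod n (\<lambda>k. M (\<alpha> k) (\<alpha>' k))))"
  have rot: "(\<Sum>i\<in>{1..n}. trace (ordered_prod n (\<lambda>k. mult_row i U M (\<alpha> k) (\<alpha>' k))))
      = (\<Sum>m\<in>{1..n}. F (\<alpha> \<circ> rot n m) (\<alpha>' \<circ> rot n m))" if "\<alpha> \<in> ?P" for \<alpha> \<alpha>'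
  proof -
    have \<alpha>: "\<alpha> permutes {1..n}" using that by simp
    \<comment> \<open>Row \<open>i\<close> is used at exactly one position \<open>m\<close>, the one
      with \<open>\<alpha> m = i\<close>; the sum over rows thus becomes a sum over
      positions.\<close>
    have "(\<Sum>i\<in>{1..n}. trace (ordered_prod n (\<lambda>k. mult_row i U M (\<alpha> k) (\<alpha>' k))))
        = (\<Sum>m\<in>{1..n}. trace (ordered_prod n (\<lambda>k. mult_row (\<alpha> m) U M (\<alpha> k) (\<alpha>' k))))"
      by (rule sum.permute[OF \<alpha>, unfolded o_def])
    also have "\<dots> = (\<Sum>m\<in>{1..n}. F (\<alpha> \<circ> rot n m) (\<alpha>' \<circ> rot n m))"
      using trace_ordered_prod_mult_at[of _ n U "\<lambda>k. M (\<alpha> k) (\<alpha>' k)"]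
      by (intro sum.cong) (simp_all add: F_def mult_row_def inj_eq[OF permutes_inj[OF \<alpha>]] o_def)
    finally show ?thesis .
  qed
  \<comment> \<open>Composing both permutations with \<open>c\<close> permutes the pairs and keeps
    the sign, since \<open>c\<close> cancels in \<alpha>' \<circ> inv \<alpha>. This is the symmetry
    that the symmetrized determinant has and the determinant lacks.\<close>
  have shift: "(\<Sum>\<alpha>\<in>?P. \<Sum>\<alpha>'\<in>?P. s \<alpha> \<alpha>' *\<^sub>R F (\<alpha> \<circ> c) (\<alpha>' \<circ> c)) = (\<Sum>\<alpha>\<in>?P. \<Sum>\<alpha>'\<in>?P. s \<alpha> \<alpha>' *\<^sub>R F \<alpha> \<alpha>')"
    if c: "c permutes {1..n}" for c
  proof -
    have "s (\<alpha> \<circ> c) (\<alpha>' \<circ> c) = s \<alpha> \<alpha>'" if "\<alpha> \<in> ?P" for \<alpha> \<alpha>'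
    proof -
      have "(\<alpha>' \<circ> c) \<circ> inv (\<alpha> \<circ> c) = \<alpha>' \<circ> (c \<circ> inv c) \<circ> inv \<alpha>"
        using that permutes_bij[OF c] by (simp add: o_inv_distrib permutes_bij o_assoc)
      then show ?thesis using permutes_inv_o(1)[OF c] by (simp add: s_def)
    qed
    then have "(\<Sum>\<alpha>\<in>?P. \<Sum>\<alpha>'\<in>?P. s \<alpha> \<alpha>' *\<^sub>R F (\<alpha> \<circ> c) (\<alpha>' \<circ> c))
      = (\<Sum>\<alpha>\<in>?P. \<Sum>\<alpha>'\<in>?P. s (\<alpha> \<circ> c) (\<alpha>' \<circ> c) *\<^sub>R F (\<alpha> \<circ> c) (\<alpha>' \<circ> c))"
      by (intro sum.cong) auto
    also have "\<dots> = (\<Sum>\<alpha>\<in>?P. \<Sum>\<alpha>'\<in>?P. s (\<alpha> \<circ> c) \<alpha>' *\<^sub>R F (\<alpha> \<circ> c) \<alpha>')"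
      by (intro sum.cong refl sum_permutations_compose_right[OF c, symmetric])
    also have "\<dots> = (\<Sum>\<alpha>\<in>?P. \<Sum>\<alpha>'\<in>?P. s \<alpha> \<alpha>' *\<^sub>R F \<alpha> \<alpha>')"
      by (rule sum_permutations_compose_right[OF c, symmetric])
    finally show ?thesis .
  qed
  have "(\<Sum>i\<in>{1..n}. trace (nc_sdet n (mult_row i U M)))
    = (1 / fact n) *\<^sub>R (\<Sum>i\<in>{1..n}. \<Sum>\<alpha>\<in>?P. \<Sum>\<alpha>'\<in>?P.
        s \<alpha> \<alpha>' *\<^sub>R trace (ordered_prod n (\<lambda>k. mult_row i U M (\<alpha> k) (\<alpha>' k))))"
    by (simp add: nc_sdet_def trace_scaleR trace_sum s_def scaleR_sum_right)
  also have "\<dots> = (1 / fact n) *\<^sub>R (\<Sum>\<alpha>\<in>?P. \<Sum>\<alpha>'\<in>?P.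
        s \<alpha> \<alpha>' *\<^sub>R (\<Sum>i\<in>{1..n}. trace (ordered_prod n (\<lambda>k. mult_row i U M (\<alpha> k) (\<alpha>' k)))))"
    unfolding sum.swap[of _ ?P "{1..n}"] by (simp only: scaleR_sum_right)
  also have "\<dots> = (1 / fact n) *\<^sub>R (\<Sum>\<alpha>\<in>?P. \<Sum>\<alpha>'\<in>?P. \<Sum>m\<in>{1..n}.
        s \<alpha> \<alpha>' *\<^sub>R F (\<alpha> \<circ> rot n m) (\<alpha>' \<circ> rot n m))"
    using rot by (simp add: scaleR_sum_right)
  also have "\<dots> = (1 / fact n) *\<^sub>R (\<Sum>m\<in>{1..n}. \<Sum>\<alpha>\<in>?P. \<Sum>\<alpha>'\<in>?P.
        s \<alpha> \<alpha>' *\<^sub>R F (\<alpha> \<circ> rot n m) (\<alpha>' \<circ> rot n m))"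
    unfolding sum.swap[of _ ?P "{1..n}"] by rule
  \<comment> \<open>All \<open>n\<close> rotations contribute the same double sum, whence the factor
    \<open>n\<close>.\<close>
  also have "\<dots> = (1 / fact n) *\<^sub>R (\<Sum>m\<in>{1..n}. \<Sum>\<alpha>\<in>?P. \<Sum>\<alpha>'\<in>?P. s \<alpha> \<alpha>' *\<^sub>R F \<alpha> \<alpha>')"
    using shift[OF rot_permutes] by simp
  also have "\<dots> = of_nat n * trace (U ** nc_sdet n M)"
    by (simp add: nc_sdet_def mat_mult_sum_right mat_mult_scaleR_right trace_scaleR trace_sum s_def F_def)
  finally show ?thesis .
qed

section \<open>Measurability and restriction to the relevant entries\<close>

lemma borel_measurable_mat_mult [measurable (raw)]:
  fixes f g :: "'a \<Rightarrow> complex^'d^'d"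
  assumes "f \<in> borel_measurable N" "g \<in> borel_measurable N"
  shows "(\<lambda>x. f x ** g x) \<in> borel_measurable N"
  using assms
  by (rule borel_measurable_continuous_Pair) (auto simp: matrix_matrix_mult_def intro!: continuous_intros)

lemma borel_measurable_trace [measurable (raw)]:
  fixes f :: "'a \<Rightarrow> complex^'d^'d"
  assumes "f \<in> borel_measurable N"
  shows "(\<lambda>x. trace (f x)) \<in> borel_measurable N"
  using _ assms by (rule borel_measurable_continuous_on) (auto simp: trace_def intro!: continuous_intros)

lemma borel_measurable_frob_norm_sq [measurable (raw)]:
  fixes f :: "'a \<Rightarrow> complex^'d^'d"
  assumes "f \<in> borel_measurable N"
  shows "(\<lambda>x. frob_norm_sq (f x)) \<in> borel_measurable N"
  using _ assms by (rule borel_measurable_continuous_on) (auto simp: frob_norm_sq_eq_sum intro!: continuous_intros)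

lemma borel_measurable_ordered_prod:
  assumes "\<And>i. i \<in> {1..n} \<Longrightarrow> (\<lambda>x. f x i :: complex^'d^'d) \<in> borel_measurable N"
  shows "(\<lambda>x. ordered_prod n (f x)) \<in> borel_measurable N"
proof -
  have "(\<lambda>x. mat_list_prod (map (f x) ks)) \<in> borel_measurable N" if "set ks \<subseteq> {1..n}" for ks
    using that by (induction ks) (auto intro!: borel_measurable_mat_mult assms)
  then show ?thesis
    unfolding ordered_prod_eq by (simp add: atLeastLessThanSuc_atLeastAtMost del: upt_Suc)
qed

lemma borel_measurable_nc_det:
  assumes "\<And>i j. i \<in> {1..n} \<Longrightarrow> j \<in> {1..n} \<Longrightarrow> (\<lambda>x. M x i j :: complex^'d^'d) \<in> borel_measurable N"
  shows "(\<lambda>x. nc_det n (M x)) \<in> borel_measurable N"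
  unfolding nc_det_def
  by (intro borel_measurable_sum borel_measurable_scaleR borel_measurable_const borel_measurable_ordered_prod assms)
     (auto simp: permutes_in_image simp del: atLeastAtMost_iff)

lemma borel_measurable_nc_sdet:
  assumes "\<And>i j. i \<in> {1..n} \<Longrightarrow> j \<in> {1..n} \<Longrightarrow> (\<lambda>x. M x i j :: complex^'d^'d) \<in> borel_measurable N"
  shows "(\<lambda>x. nc_sdet n (M x)) \<in> borel_measurable N"
  unfolding nc_sdet_def
  by (intro borel_measurable_sum borel_measurable_scaleR borel_measurable_const borel_measurable_ordered_prod assms)
     (auto simp: permutes_in_image simp del: atLeastAtMost_iff)

text \<open>This and the next lemma allow the determinants to be evaluated on families restricted to
  \<open>{1..n} \<times> {1..n}\<close>, which are \<open>undefined\<close> outside.\<close>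

lemma nc_det_cong:
  assumes "\<And>i j. i \<in> {1..n} \<Longrightarrow> j \<in> {1..n} \<Longrightarrow> M i j = M' i j"
  shows "nc_det n M = nc_det n M'"
  unfolding nc_det_def
  by (intro sum.cong refl arg_cong2[where f = scaleR] ordered_prod_cong assms)
     (auto simp: permutes_in_image simp del: atLeastAtMost_iff)

lemma nc_sdet_cong:
  assumes "\<And>i j. i \<in> {1..n} \<Longrightarrow> j \<in> {1..n} \<Longrightarrow> M i j = M' i j"
  shows "nc_sdet n M = nc_sdet n M'"
  unfolding nc_sdet_def
  by (intro sum.cong refl arg_cong2[where f = scaleR] ordered_prod_cong assms)
     (auto simp: permutes_in_image simp del: atLeastAtMost_iff)

section \<open>Invariance of the laws\<close>

text \<open>Reindexing by an injection leaves the coordinates independent with law \<open>N\<close>.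
  Measurable maps of single coordinates preserve independence, and these maps preserve each
  marginal, so the joint law is again the product.\<close>

lemma distr_PiM_iid_reindex_transform:
  fixes \<pi> :: "'i::finite \<Rightarrow> 'i"
  assumes N: "prob_space N" and inj: "inj \<pi>"
    and [measurable]: "\<And>k. f k \<in> measurable N N" and f: "\<And>k. distr N N (f k) = N"
  shows "distr (PiM UNIV (\<lambda>_. N)) (PiM UNIV (\<lambda>_. N)) (\<lambda>x k. f k (x (\<pi> k))) = PiM UNIV (\<lambda>_. N)"
proof -
  let ?Q = "PiM (UNIV :: 'i set) (\<lambda>_. N)"
  interpret Q: prob_space ?Q by (rule prob_space_PiM) (rule N)
  have coord: "distr ?Q N (\<lambda>x. x k) = N" for k
    using distr_PiM_component[of UNIV "\<lambda>_. N" k] N by simp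
  have "distr ?Q ?Q (\<lambda>x. \<lambda>k\<in>UNIV. x (\<pi> k)) = ?Q"
    using distr_PiM_reindex[of UNIV "\<lambda>_. N" \<pi> UNIV] N inj by simp
  then have "Q.indep_vars (\<lambda>_. N) (\<lambda>k x. x (\<pi> k)) UNIV"
    by (subst Q.indep_vars_iff_distr_eq_PiM') (simp_all add: coord)
  then have "Q.indep_vars (\<lambda>_. N) (\<lambda>k x. f k (x (\<pi> k))) UNIV"
    by (rule Q.indep_vars_compose2) simp
  then have "distr ?Q ?Q (\<lambda>x. \<lambda>k\<in>UNIV. f k (x (\<pi> k))) = (\<Pi>\<^sub>M k\<in>UNIV. distr ?Q N (\<lambda>x. f k (x (\<pi> k))))"
    by (subst (asm) Q.indep_vars_iff_distr_eq_PiM') simp_all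
  also have "\<dots> = ?Q"
  proof -
    have "distr ?Q N (\<lambda>x. f k (x (\<pi> k))) = N" for k
      using distr_distr[of "f k" N N "\<lambda>x. x (\<pi> k)" ?Q] by (simp add: coord f o_def)
    then show ?thesis by simp
  qed
  finally show ?thesis by (simp add: restrict_def)
qed

text \<open>An affine image of a normal variable is normal; here the mean stays 0 and the standard
  deviation is multiplied by \<open>\<bar>c\<bar> = 1\<close>.\<close>

lemma centered_normal_sign_invariant:
  fixes \<sigma> c :: real
  assumes "0 < \<sigma>" "\<bar>c\<bar> = 1"
  defines "N \<equiv> density lborel (normal_density 0 \<sigma>)"
  shows "distr N N (\<lambda>x. c * x) = N"
proof -
  interpret N: prob_space N unfolding N_def using assms(1) by (rule prob_space_normal_density)
  have "distr N lborel (\<lambda>x. x) = N" by (rule distr_id2) (simp add: N_def)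
  then have "distributed N lborel (\<lambda>x. x) (normal_density 0 \<sigma>)"
    by (simp add: distributed_def N_def)
  from N.normal_density_affine[OF this, of c 0]
  have "distributed N lborel (\<lambda>x. c * x) (normal_density 0 \<sigma>)"
    using assms by auto
  then have "distr N lborel (\<lambda>x. c * x) = N"
    by (simp add: distributed_def N_def)
  moreover have "distr N N (\<lambda>x. c * x) = distr N lborel (\<lambda>x. c * x)"
    by (rule distr_cong) (simp_all add: N_def)
  ultimately show ?thesis by simp
qed

lemma gaussian_matrix_measure_signed_perm_invariant:
  fixes \<sigma> :: "'d::finite \<Rightarrow> 'd"
  assumes "inj \<sigma>"
  shows "distr gaussian_matrix_measure borel (\<lambda>V. signed_perm_matrix \<sigma> s ** V) = gaussian_matrix_measure"
proof -
  define N where "N = density lborel (normal_density 0 (sqrt (1 / (2 * real CARD('d)))))"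
  define c where "c = (\<lambda>i. if s i then 1 else -1 :: real)"
  \<comment> \<open>Multiplication by the matrix permutes rows by \<open>\<pi>\<close> and reflects
    them by \<open>f\<close>. The signs are real, so real and imaginary parts are never
    mixed.\<close>
  define f where "f = (\<lambda>k :: 'd \<times> 'd \<times> bool. \<lambda>y. c (fst k) * y)"
  define \<pi> where "\<pi> = (\<lambda>k :: 'd \<times> 'd \<times> bool. (\<sigma> (fst k), snd k))"
  let ?Q = "PiM (UNIV :: ('d \<times> 'd \<times> bool) set) (\<lambda>_. N)"
  let ?G = "\<lambda>x :: 'd \<times> 'd \<times> bool \<Rightarrow> real. (\<chi> i j. Complex (x (i, j, True)) (x (i, j, False))) :: complex^'d^'d"
  have gauss: "gaussian_matrix_measure = distr ?Q borel ?G"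
    by (simp add: gaussian_matrix_measure_def N_def)
  have sets_N [measurable_cong]: "sets N = sets borel" by (simp add: N_def)
  have coord [measurable]: "(\<lambda>x. x k) \<in> borel_measurable ?Q" for k
    using measurable_component_singleton[of k UNIV "\<lambda>_. N"] by (simp add: measurable_cong_sets[OF refl sets_N])
  have G [measurable]: "?G \<in> borel_measurable ?Q"
  proof -
    have [simp]: "(\<Sum>b\<in>UNIV. if P then g b else 0) = (if P then sum g UNIV else 0)"
      for P and g :: "'d \<Rightarrow> real"
      by simp
    \<comment> \<open>In a real basis of the matrix space the coordinates of \<open>x\<close> become
      coefficients, and measurability reduces to that of single coordinates.\<close>
    have eq: "?G = (\<lambda>x. \<Sum>i\<in>UNIV. \<Sum>j\<in>UNIV.
        x (i, j, True) *\<^sub>R axis i (axis j 1) + x (i, j, False) *\<^sub>R axis i (axis j \<i>))"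
      by (auto simp: fun_eq_iff vec_eq_iff axis_def complex_eq_iff if_distrib[where f = "\<lambda>v. v $ _"]
          if_distrib[where f = Re] if_distrib[where f = Im] if_distrib[where f = "\<lambda>y. _ * y"]
          sum.distrib sum.delta' cong: if_cong)
    show ?thesis unfolding eq by measurable
  qed
  have f [measurable]: "f k \<in> measurable N N" for k
    unfolding f_def by measurable
  have "distr ?Q ?Q (\<lambda>x k. f k (x (\<pi> k))) = ?Q"
  proof (rule distr_PiM_iid_reindex_transform)
    show "prob_space N" unfolding N_def by (rule prob_space_normal_density) simp
    show "inj \<pi>" using assms by (auto simp: inj_def \<pi>_def)
    show "distr N N (f k) = N" for k
      unfolding N_def f_def by (rule centered_normal_sign_invariant) (auto simp: c_def)
  qed measurable
  moreover have T: "(\<lambda>x k. f k (x (\<pi> k))) \<in> measurable ?Q ?Q"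
  proof (rule measurable_PiM_single')
    show "(\<lambda>x. f k (x (\<pi> k))) \<in> measurable ?Q N" for k
      using measurable_compose[OF _ f, of "\<lambda>x. x (\<pi> k)" ?Q k] measurable_component_singleton[of "\<pi> k" UNIV "\<lambda>_. N"]
      by simp
  qed (simp add: N_def space_PiM)
  moreover have "signed_perm_matrix \<sigma> s ** ?G x = ?G (\<lambda>k. f k (x (\<pi> k)))" for x
    by (simp add: vec_eq_iff signed_perm_matrix_mult_nth f_def \<pi>_def c_def complex_eq_iff)
  then have "distr gaussian_matrix_measure borel (\<lambda>V. signed_perm_matrix \<sigma> s ** V)
      = distr (distr ?Q ?Q (\<lambda>x k. f k (x (\<pi> k)))) borel ?G"
    using T unfolding gauss by (simp add: distr_distr o_def)
  ultimately show ?thesis by (simp add: gauss)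
qed

text \<open>Both families are independent with the same marginals, so they have the same joint law.
  The map may vary with the index, so that a single row can be altered.\<close>

lemma (in prob_space) nn_integral_indep_transform:
  assumes "I \<noteq> {}" "indep_vars (\<lambda>_. borel) Y I"
    and T: "\<And>i. i \<in> I \<Longrightarrow> T i \<in> borel_measurable borel"
    and inv: "\<And>i. i \<in> I \<Longrightarrow> distr (distr M borel (Y i)) borel (T i) = distr M borel (Y i)"
    and \<Phi>: "\<Phi> \<in> borel_measurable (PiM I (\<lambda>_. borel))"
  shows "(\<integral>\<^sup>+x. \<Phi> (\<lambda>i\<in>I. T i (Y i x)) \<partial>M) = (\<integral>\<^sup>+x. \<Phi> (\<lambda>i\<in>I. Y i x) \<partial>M)"
proof -
  have Y [measurable]: "Y i \<in> borel_measurable M" if "i \<in> I" for i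
    using assms(2) that by (auto simp: indep_vars_def)
  have TY [measurable]: "(\<lambda>x. T i (Y i x)) \<in> borel_measurable M" if "i \<in> I" for i
    using measurable_compose[OF Y T] that by blast
  have law: "distr M (PiM I (\<lambda>_. borel)) (\<lambda>x. \<lambda>i\<in>I. Y i x) = PiM I (\<lambda>i. distr M borel (Y i))"
    using assms(1,2) by (subst (asm) indep_vars_iff_distr_eq_PiM') simp_all
  have "indep_vars (\<lambda>_. borel) (\<lambda>i x. T i (Y i x)) I"
    using assms(2) T by (rule indep_vars_compose2)
  then have "distr M (PiM I (\<lambda>_. borel)) (\<lambda>x. \<lambda>i\<in>I. T i (Y i x)) = PiM I (\<lambda>i. distr M borel (\<lambda>x. T i (Y i x)))"
    using assms(1) by (subst (asm) indep_vars_iff_distr_eq_PiM') simp_all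
  also have "\<dots> = PiM I (\<lambda>i. distr M borel (Y i))"
    using inv T by (intro PiM_cong) (simp_all add: distr_distr o_def)
  finally have "distr M (PiM I (\<lambda>_. borel)) (\<lambda>x. \<lambda>i\<in>I. T i (Y i x)) = distr M (PiM I (\<lambda>_. borel)) (\<lambda>x. \<lambda>i\<in>I. Y i x)"
    unfolding law .
  then show ?thesis
    using nn_integral_distr[of "\<lambda>x. \<lambda>i\<in>I. Y i x" M "PiM I (\<lambda>_. borel)" \<Phi>]
      nn_integral_distr[of "\<lambda>x. \<lambda>i\<in>I. T i (Y i x)" M "PiM I (\<lambda>_. borel)" \<Phi>] \<Phi>
    by (simp add: measurable_restrict)
qed

text \<open>The common property through which both kinds of measure enter the moment
  comparison.\<close>

lemma signed_perm_invariant: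
  fixes \<mu> :: "(complex^'d^'d) measure"
  assumes "is_haar_unitary \<mu> \<or> \<mu> = gaussian_matrix_measure" "\<sigma> permutes UNIV"
  shows "distr \<mu> borel (\<lambda>V. signed_perm_matrix \<sigma> s ** V) = \<mu>"
  using assms(1) gaussian_matrix_measure_signed_perm_invariant[OF permutes_inj[OF assms(2)]]
    signed_perm_matrix_unitary[OF permutes_inj[OF assms(2)]]
  by (auto simp: is_haar_unitary_def)

section \<open>Convexity and moment ratios\<close>

text \<open>Convexity of the second and fourth powers, applied to the average \<open>z\<close> of
  the \<open>w i\<close>. Cauchy-Schwarz gives the square; applying it again to the squares gives
  the fourth power.\<close>

lemma card_mult_power_cmod_le:
  fixes z :: complex and w :: "'b \<Rightarrow> complex"
  assumes J: "finite J" "J \<noteq> {}" and z: "of_nat (card J) * z = (\<Sum>i\<in>J. w i)" and p: "p \<in> {2, 4 :: nat}"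
  shows "real (card J) * cmod z ^ p \<le> (\<Sum>i\<in>J. cmod (w i) ^ p)"
proof -
  let ?m = "real (card J)"
  have m: "0 < ?m" using J by (simp add: card_gt_0_iff)
  have "?m * cmod z = cmod (\<Sum>i\<in>J. w i)"
    by (simp add: z[symmetric] norm_mult)
  also have "\<dots> \<le> (\<Sum>i\<in>J. cmod (w i))" by (rule norm_sum)
  finally have le: "?m * cmod z \<le> (\<Sum>i\<in>J. cmod (w i))" .
  have step: "?m * x\<^sup>2 \<le> (\<Sum>i\<in>J. (g i)\<^sup>2)" if "0 \<le> x" "?m * x \<le> (\<Sum>i\<in>J. g i)" for x and g :: "'b \<Rightarrow> real"
  proof -
    have "(?m * x)\<^sup>2 \<le> (\<Sum>i\<in>J. g i)\<^sup>2" using that m by (intro power_mono) auto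
    also have "\<dots> \<le> (\<Sum>i\<in>J. (g i)\<^sup>2) * ?m" by (rule sum_squared_le_sum_of_squares)
    finally have "?m * (?m * x\<^sup>2) \<le> ?m * (\<Sum>i\<in>J. (g i)\<^sup>2)"
      by (simp add: power2_eq_square mult_ac)
    then show ?thesis using m by simp
  qed
  have two: "?m * (cmod z)\<^sup>2 \<le> (\<Sum>i\<in>J. (cmod (w i))\<^sup>2)"
    by (rule step[OF norm_ge_zero le])
  have "?m * ((cmod z)\<^sup>2)\<^sup>2 \<le> (\<Sum>i\<in>J. ((cmod (w i))\<^sup>2)\<^sup>2)"
    by (rule step[OF zero_le_power2 two])
  with two p show ?thesis by (auto simp flip: power_mult)
qed

text \<open>\<open>enn2real\<close> sends infinity to 0, so an infinite \<open>v\<close> could break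
  the bound; the reverse comparison then makes \<open>u\<close> infinite too, and both sides are
  0.\<close>

lemma enn2real_le_scaled:
  assumes "u \<le> ennreal c * v" "v \<le> ennreal c * u" "0 \<le> c"
  shows "enn2real u \<le> c * enn2real v"
proof (cases "v = \<infinity>")
  case True
  then have "u = \<infinity>" using assms(2) by (auto simp: ennreal_mult_eq_top_iff top.extremum_unique)
  then show ?thesis by (simp add: True)
next
  case False
  then have "ennreal c * v < \<infinity>" by (simp add: ennreal_mult_less_top top.not_eq_extremum)
  then have "enn2real u \<le> enn2real (ennreal c * v)" using assms(1) by (intro enn2real_mono) auto
  then show ?thesis using assms(3) by (simp add: enn2real_mult)
qed

text \<open>The factor \<open>d ^ 4\<close> combines \<open>d\<^sup>2\<close> from the comparison of
  \<open>b2\<close> with \<open>a2\<close> and \<open>d\<^sup>2\<close> from squaring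
  \<open>a \<le> d * b\<close> in the denominators.\<close>

lemma moment_ratio_le:
  fixes a b a2 b2 d :: real
  assumes "0 \<le> a" "0 \<le> b" "0 \<le> a2" "0 \<le> b2" "0 < d" "a \<le> d * b" "b \<le> d * a" "b2 \<le> d\<^sup>2 * a2"
  shows "b2 / b\<^sup>2 \<le> d ^ 4 * (a2 / a\<^sup>2)"
proof (cases "b = 0")
  \<comment> \<open>Division by zero gives 0 on the left.\<close>
  case True
  then show ?thesis using assms by simp
next
  case False
  then have "0 < b" "0 < a" using assms by (auto simp: less_le)
  have "a\<^sup>2 \<le> (d * b)\<^sup>2" using assms by (intro power_mono) auto
  then have "b2 * a\<^sup>2 \<le> (d\<^sup>2 * a2) * (d * b)\<^sup>2" using assms by (intro mult_mono) auto
  then show ?thesis using \<open>0 < b\<close> \<open>0 < a\<close>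
    by (simp add: field_simps power_mult_distrib power2_eq_square power4_eq_xxxx)
qed

text \<open>The hypotheses are symmetric in the two pairs, so the lower bound is the upper bound
  with the roles exchanged.\<close>

lemma moment_ratio_bounds:
  fixes a b a2 b2 d :: real
  assumes "0 \<le> a" "0 \<le> b" "0 \<le> a2" "0 \<le> b2" "0 < d"
    and "a \<le> d * b" "b \<le> d * a" "a2 \<le> d\<^sup>2 * b2" "b2 \<le> d\<^sup>2 * a2"
  shows "1 / d ^ 4 * (a2 / a\<^sup>2) \<le> b2 / b\<^sup>2 \<and> b2 / b\<^sup>2 \<le> d ^ 4 * (a2 / a\<^sup>2)"
proof -
  have "a2 / a\<^sup>2 \<le> d ^ 4 * (b2 / b\<^sup>2)"
    using assms by (intro moment_ratio_le) auto
  then have "1 / d ^ 4 * (a2 / a\<^sup>2) \<le> 1 / d ^ 4 * (d ^ 4 * (b2 / b\<^sup>2))"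
    using assms by (intro mult_left_mono) auto
  then have "1 / d ^ 4 * (a2 / a\<^sup>2) \<le> b2 / b\<^sup>2"
    using assms by simp
  moreover have "b2 / b\<^sup>2 \<le> d ^ 4 * (a2 / a\<^sup>2)"
    using assms by (intro moment_ratio_le) auto
  ultimately show ?thesis by simp
qed

text \<open>
  Working with nonnegative integrals, the four moment comparisons force the moments of the trace and
  of the norm to be infinite simultaneously, in which case both Bochner integrals are \<open>0\<close>; hence
  no integrability of the Gaussian moments is needed.
\<close>

lemma trace_frob_moment_ratio_bounds:
  fixes S :: "'a \<Rightarrow> complex^'d^'d" and P :: "'a measure"
  assumes S [measurable]: "S \<in> borel_measurable P"
    and le: "\<And>\<sigma> s p. \<sigma> permutes UNIV \<Longrightarrow> p \<in> {2, 4} \<Longrightarrow>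
      (\<integral>\<^sup>+x. ennreal (cmod (trace (signed_perm_matrix \<sigma> s ** S x)) ^ p) \<partial>P)
        \<le> (\<integral>\<^sup>+x. ennreal (cmod (trace (S x)) ^ p) \<partial>P)"
  defines "d \<equiv> real CARD('d)"
    and "X \<equiv> (\<lambda>x. (cmod (trace (S x)))\<^sup>2)"
    and "F \<equiv> (\<lambda>x. frob_norm_sq (S x))"
  shows "1 / d ^ 4 * ((\<integral>x. (X x)\<^sup>2 \<partial>P) / (\<integral>x. X x \<partial>P)\<^sup>2) \<le> (\<integral>x. (F x)\<^sup>2 \<partial>P) / (\<integral>x. F x \<partial>P)\<^sup>2
    \<and> (\<integral>x. (F x)\<^sup>2 \<partial>P) / (\<integral>x. F x \<partial>P)\<^sup>2 \<le> d ^ 4 * ((\<integral>x. (X x)\<^sup>2 \<partial>P) / (\<integral>x. X x \<partial>P)\<^sup>2)"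
proof -
  define K where "K = (signed_perm_index :: (('d \<Rightarrow> 'd) \<times> ('d \<Rightarrow> bool)) set)"
  define t where "t = (\<lambda>k x. case k of (\<sigma>, s) \<Rightarrow> cmod (trace (signed_perm_matrix \<sigma> s ** S x)))"
  have K: "finite K" "0 < real (card K)" and d: "0 < d"
    by (simp_all add: K_def finite_signed_perm_index card_signed_perm_index d_def)
  have t_meas [measurable]: "t k \<in> borel_measurable P" for k
    unfolding t_def by (cases k) simp
  have [measurable]: "X \<in> borel_measurable P" "F \<in> borel_measurable P"
    unfolding X_def F_def by measurable
  have nonneg: "0 \<le> X x" "0 \<le> F x" for x by (simp_all add: X_def F_def frob_norm_sq_nonneg)
  have X_le: "X x \<le> d * F x" for x
    unfolding X_def F_def d_def by (rule cmod_trace_sq_le)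
  have avg: "real (card K) * F x = d * (\<Sum>k\<in>K. (t k x)\<^sup>2)" for x
    using frob_norm_sq_eq_average[of "S x"] by (simp add: K_def F_def d_def t_def case_prod_unfold)
  have F_eq: "F x = d / card K * (\<Sum>k\<in>K. (t k x)\<^sup>2)" for x
  proof -
    have "F x = real (card K) * F x / real (card K)"
      using K(2) by (metis nonzero_mult_div_cancel_left less_irrefl)
    then show ?thesis unfolding avg by simp
  qed
  \<comment> \<open>Cauchy-Schwarz over \<open>K\<close> costs a factor \<open>card K\<close>, which
    cancels one of the two in the denominator of the squared average.\<close>
  have F_sq_le: "(F x)\<^sup>2 \<le> d\<^sup>2 / card K * (\<Sum>k\<in>K. (t k x) ^ 4)" for x
  proof -
    have "(\<Sum>k\<in>K. (t k x)\<^sup>2)\<^sup>2 \<le> (\<Sum>k\<in>K. ((t k x)\<^sup>2)\<^sup>2) * real (card K)"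
      by (rule sum_squared_le_sum_of_squares)
    then have "(d / card K)\<^sup>2 * (\<Sum>k\<in>K. (t k x)\<^sup>2)\<^sup>2 \<le> (d / card K)\<^sup>2 * ((\<Sum>k\<in>K. ((t k x)\<^sup>2)\<^sup>2) * real (card K))"
      by (intro mult_left_mono) auto
    also have "\<dots> = d\<^sup>2 / card K * (\<Sum>k\<in>K. (t k x) ^ 4)"
      using K(2) by (simp add: field_simps power2_eq_square power4_eq_xxxx)
    finally show ?thesis unfolding F_eq power_mult_distrib .
  qed
  \<comment> \<open>Every term of the average has the same bound by \<open>le\<close>. The instances
    used are \<open>p = 2\<close> with \<open>c = d\<close>, for \<open>b\<close>, and
    \<open>p = 4\<close> with \<open>c = d\<^sup>2\<close>, for \<open>b2\<close>.\<close>
  have sum_le: "(\<integral>\<^sup>+x. ennreal (c / card K * (\<Sum>k\<in>K. t k x ^ p)) \<partial>P)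
      \<le> ennreal c * (\<integral>\<^sup>+x. ennreal (cmod (trace (S x)) ^ p) \<partial>P)" if p: "p \<in> {2, 4}" and c: "0 \<le> c" for c p
  proof -
    have t_nonneg: "0 \<le> t k x" for k x by (simp add: t_def case_prod_unfold)
    have "(\<integral>\<^sup>+x. ennreal (c / card K * (\<Sum>k\<in>K. t k x ^ p)) \<partial>P)
        = (\<integral>\<^sup>+x. ennreal (c / card K) * (\<Sum>k\<in>K. ennreal (t k x ^ p)) \<partial>P)"
      using c t_nonneg by (simp add: sum_ennreal flip: ennreal_mult')
    also have "\<dots> = ennreal (c / card K) * (\<Sum>k\<in>K. \<integral>\<^sup>+x. ennreal (t k x ^ p) \<partial>P)"
      by (simp add: nn_integral_cmult nn_integral_sum)
    also have "\<dots> \<le> ennreal (c / card K) * (\<Sum>k\<in>K. \<integral>\<^sup>+x. ennreal (cmod (trace (S x)) ^ p) \<partial>P)"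
    proof (intro mult_left_mono sum_mono)
      fix k assume "k \<in> K"
      then show "(\<integral>\<^sup>+x. ennreal (t k x ^ p) \<partial>P) \<le> (\<integral>\<^sup>+x. ennreal (cmod (trace (S x)) ^ p) \<partial>P)"
        using le[OF _ p] by (auto simp: K_def signed_perm_index_def t_def)
    qed simp
    also have "\<dots> = ennreal (c / card K) * ennreal (card K) * (\<integral>\<^sup>+x. ennreal (cmod (trace (S x)) ^ p) \<partial>P)"
      by (simp add: ennreal_of_nat_eq_real_of_nat mult.assoc)
    also have "ennreal (c / card K) * ennreal (card K) = ennreal c"
      using c K(2) by (auto simp flip: ennreal_mult')
    finally show ?thesis .
  qed
  define a b a2 b2 where "a = (\<integral>\<^sup>+x. ennreal (X x) \<partial>P)" and "b = (\<integral>\<^sup>+x. ennreal (F x) \<partial>P)"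
    and "a2 = (\<integral>\<^sup>+x. ennreal ((X x)\<^sup>2) \<partial>P)" and "b2 = (\<integral>\<^sup>+x. ennreal ((F x)\<^sup>2) \<partial>P)"
  have ab: "a \<le> ennreal d * b"
    unfolding a_def b_def using X_le d nonneg
    by (subst nn_integral_cmult[symmetric]) (auto intro!: nn_integral_mono ennreal_leI simp flip: ennreal_mult')
  have ba: "b \<le> ennreal d * a"
    using sum_le[of 2 d] d unfolding a_def b_def X_def F_eq by simp
  have ab2: "a2 \<le> ennreal (d\<^sup>2) * b2"
  proof -
    have "(X x)\<^sup>2 \<le> d\<^sup>2 * (F x)\<^sup>2" for x
      using power_mono[OF X_le nonneg(1), of x 2] by (simp add: power_mult_distrib)
    then show ?thesis
      unfolding a2_def b2_def
      by (subst nn_integral_cmult[symmetric]) (auto intro!: nn_integral_mono ennreal_leI simp flip: ennreal_mult')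
  qed
  have ba2: "b2 \<le> ennreal (d\<^sup>2) * a2"
  proof -
    have "b2 \<le> (\<integral>\<^sup>+x. ennreal (d\<^sup>2 / card K * (\<Sum>k\<in>K. t k x ^ 4)) \<partial>P)"
      unfolding b2_def by (intro nn_integral_mono ennreal_leI F_sq_le)
    also have "\<dots> \<le> ennreal (d\<^sup>2) * a2"
      using sum_le[of 4 "d\<^sup>2"] unfolding a2_def X_def by (simp flip: power_mult)
    finally show ?thesis .
  qed
  have "(\<integral>x. X x \<partial>P) = enn2real a" "(\<integral>x. F x \<partial>P) = enn2real b"
    "(\<integral>x. (X x)\<^sup>2 \<partial>P) = enn2real a2" "(\<integral>x. (F x)\<^sup>2 \<partial>P) = enn2real b2"
    unfolding a_def b_def a2_def b2_def using nonneg by (auto intro!: integral_eq_nn_integral)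
  then show ?thesis
    using moment_ratio_bounds[of "enn2real a" "enn2real b" "enn2real a2" "enn2real b2" d] d
      enn2real_le_scaled[OF ab ba] enn2real_le_scaled[OF ba ab]
      enn2real_le_scaled[OF ab2 ba2] enn2real_le_scaled[OF ba2 ab2]
    by simp
qed

section \<open>Moments of the trace after multiplication by a matrix\<close>

text \<open>\<open>f\<close> stands for either determinant and \<open>J\<close> for the rows over
  which \<open>avg\<close> averages. Multiplying a row by \<open>U\<close> preserves the joint law,
  so all terms of the average have the same moment, and convexity concludes. Measurability is
  assumed on two sample spaces: the index families, for \<open>\<Phi>\<close>, and the original
  one.\<close>

lemma trace_power_moment_mult_le:
  fixes P :: "'w measure" and \<mu> :: "(complex^'d^'d) measure" and \<rho> :: "nat \<Rightarrow> nat \<Rightarrow> 'w \<Rightarrow> complex^'d^'d"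
    and A :: "nat \<Rightarrow> nat \<Rightarrow> real" and U :: "complex^'d^'d"
    and f :: "(nat \<Rightarrow> nat \<Rightarrow> complex^'d^'d) \<Rightarrow> complex^'d^'d"
  assumes P: "prob_space P"
    and inv: "distr \<mu> borel (\<lambda>V. U ** V) = \<mu>"
    and indep: "prob_space.indep_vars P (\<lambda>_. borel) (\<lambda>(i, j). \<rho> i j) ({1..n} \<times> {1..n})"
    and law: "\<And>i j. i \<in> {1..n} \<Longrightarrow> j \<in> {1..n} \<Longrightarrow> distr P borel (\<rho> i j) = \<mu>"
    and f_meas: "\<And>(N :: (nat \<times> nat \<Rightarrow> complex^'d^'d) measure) M.
      (\<And>i j. i \<in> {1..n} \<Longrightarrow> j \<in> {1..n} \<Longrightarrow> (\<lambda>x. M x i j) \<in> borel_measurable N) \<Longrightarrow> (\<lambda>x. f (M x)) \<in> borel_measurable N"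
    and f_meas': "\<And>(N :: 'w measure) M.
      (\<And>i j. i \<in> {1..n} \<Longrightarrow> j \<in> {1..n} \<Longrightarrow> (\<lambda>x. M x i j) \<in> borel_measurable N) \<Longrightarrow> (\<lambda>x. f (M x)) \<in> borel_measurable N"
    and f_cong: "\<And>M M'. (\<And>i j. i \<in> {1..n} \<Longrightarrow> j \<in> {1..n} \<Longrightarrow> M i j = M' i j) \<Longrightarrow> f M = f M'"
    and J: "J \<subseteq> {1..n}" "J \<noteq> {}"
    and avg: "\<And>M. of_nat (card J) * trace (U ** f M) = (\<Sum>i\<in>J. trace (f (mult_row i U M)))"
    and p: "p \<in> {2, 4}"
  defines "M \<equiv> (\<lambda>\<omega> i j. A i j *\<^sub>R \<rho> i j \<omega>)"
  shows "(\<integral>\<^sup>+\<omega>. ennreal (cmod (trace (U ** f (M \<omega>))) ^ p) \<partial>P) \<le> (\<integral>\<^sup>+\<omega>. ennreal (cmod (trace (f (M \<omega>))) ^ p) \<partial>P)"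
proof -
  interpret prob_space P by (rule P)
  let ?I = "{1..n} \<times> {1..n}"
  have finJ: "finite J" using J(1) finite_subset by blast
  have cardJ: "0 < real (card J)" using finJ J(2) by (simp add: card_gt_0_iff)
  have \<rho>: "\<rho> i j \<in> borel_measurable P" if "i \<in> {1..n}" "j \<in> {1..n}" for i j
    using indep that unfolding indep_vars_def by fastforce
  define \<Phi> where "\<Phi> = (\<lambda>x. ennreal (cmod (trace (f (\<lambda>i j. A i j *\<^sub>R x (i, j)))) ^ p))"
  have comp: "(\<lambda>x. A i j *\<^sub>R x (i, j)) \<in> borel_measurable (PiM ?I (\<lambda>_. borel :: (complex^'d^'d) measure))"
    if "i \<in> {1..n}" "j \<in> {1..n}" for i j
    by (intro borel_measurable_scaleR borel_measurable_const measurable_component_singleton) (use that in auto)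
  have [measurable]: "(\<lambda>x. f (\<lambda>i j. A i j *\<^sub>R x (i, j))) \<in> borel_measurable (PiM ?I (\<lambda>_. borel))"
    by (intro f_meas comp)
  have \<Phi>: "\<Phi> \<in> borel_measurable (PiM ?I (\<lambda>_. borel))"
    unfolding \<Phi>_def by measurable
  have row: "(\<integral>\<^sup>+\<omega>. ennreal (cmod (trace (f (mult_row i U (M \<omega>)))) ^ p) \<partial>P)
      = (\<integral>\<^sup>+\<omega>. ennreal (cmod (trace (f (M \<omega>))) ^ p) \<partial>P)" if i: "i \<in> J" for i
  proof -
    define T where "T = (\<lambda>k :: nat \<times> nat. \<lambda>V :: complex^'d^'d. if fst k = i then U ** V else V)"
    let ?Y = "\<lambda>k. case k of (i, j) \<Rightarrow> \<rho> i j"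
    have I: "?I \<noteq> {}" using i J by auto
    have T: "T k \<in> borel_measurable borel" for k
      by (cases "fst k = i") (simp_all add: T_def borel_measurable_mat_mult)
    have Tinv: "distr (distr P borel (?Y k)) borel (T k) = distr P borel (?Y k)" if "k \<in> ?I" for k
    proof -
      have "distr P borel (?Y k) = \<mu>" using law that by (cases k) auto
      \<comment> \<open>In the other rows \<open>T k\<close> is the identity, whose
        \<open>distr\<close> into \<open>borel\<close> is \<open>\<mu>\<close> only if
        \<open>\<mu>\<close> is a Borel measure; invariance exhibits it as one.\<close>
      moreover have "sets \<mu> = sets borel" by (subst inv[symmetric]) simp
      ultimately show ?thesis by (cases "fst k = i") (simp_all add: T_def inv distr_id2)
    qed
    \<comment> \<open>\<open>U\<close> commutes with the real scalars \<open>A i j\<close>, so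
      altering row \<open>i\<close> of \<open>\<rho>\<close> alters row \<open>i\<close> of
      \<open>M\<close> in the same way.\<close>
    have 1: "\<Phi> (\<lambda>k\<in>?I. T k (?Y k \<omega>)) = ennreal (cmod (trace (f (mult_row i U (M \<omega>)))) ^ p)" for \<omega>
      unfolding \<Phi>_def by (intro arg_cong[where f = "\<lambda>V. ennreal (cmod (trace V) ^ p)"] f_cong)
        (auto simp: T_def M_def mult_row_def mat_mult_scaleR_right)
    have 2: "\<Phi> (\<lambda>k\<in>?I. ?Y k \<omega>) = ennreal (cmod (trace (f (M \<omega>))) ^ p)" for \<omega>
      unfolding \<Phi>_def by (intro arg_cong[where f = "\<lambda>V. ennreal (cmod (trace V) ^ p)"] f_cong)
        (auto simp: M_def)
    show ?thesis
      using nn_integral_indep_transform[OF I indep T Tinv \<Phi>] unfolding 1 2 .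
  qed
  have meas: "(\<lambda>\<omega>. f (mult_row i U (M \<omega>))) \<in> borel_measurable P" for i
  proof (rule f_meas')
    show "(\<lambda>\<omega>. mult_row i U (M \<omega>) k l) \<in> borel_measurable P" if "k \<in> {1..n}" "l \<in> {1..n}" for k l
      using \<rho>[OF that]
      by (cases "k = i") (auto simp: mult_row_def M_def intro!: borel_measurable_mat_mult borel_measurable_scaleR)
  qed
  have "ennreal (card J) * (\<integral>\<^sup>+\<omega>. ennreal (cmod (trace (U ** f (M \<omega>))) ^ p) \<partial>P)
      = (\<integral>\<^sup>+\<omega>. ennreal (card J * cmod (trace (U ** f (M \<omega>))) ^ p) \<partial>P)"
  proof -
    have "(\<lambda>\<omega>. f (M \<omega>)) \<in> borel_measurable P"
      by (rule f_meas') (auto simp: M_def intro!: borel_measurable_scaleR \<rho>)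
    then show ?thesis
      by (subst nn_integral_cmult[symmetric]) (auto simp: ennreal_mult intro!: borel_measurable_mat_mult)
  qed
  also have "\<dots> \<le> (\<integral>\<^sup>+\<omega>. (\<Sum>i\<in>J. ennreal (cmod (trace (f (mult_row i U (M \<omega>)))) ^ p)) \<partial>P)"
    using card_mult_power_cmod_le[OF finJ J(2) avg p]
    by (intro nn_integral_mono) (simp add: sum_ennreal ennreal_leI)
  also have "\<dots> = (\<Sum>i\<in>J. \<integral>\<^sup>+\<omega>. ennreal (cmod (trace (f (mult_row i U (M \<omega>)))) ^ p) \<partial>P)"
    using meas by (intro nn_integral_sum) auto
  also have "\<dots> = ennreal (card J) * (\<integral>\<^sup>+\<omega>. ennreal (cmod (trace (f (M \<omega>))) ^ p) \<partial>P)"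
    by (simp add: row ennreal_of_nat_eq_real_of_nat)
  finally show ?thesis
    using cardJ by (simp add: ennreal_mult_le_mult_iff)
qed

text \<open>This settles \<open>n = 0\<close>, where both determinants are the identity and there is
  no row to absorb the signed permutation.\<close>

lemma cmod_trace_signed_perm_matrix_le:
  "cmod (trace (signed_perm_matrix \<sigma> s ** mat 1 :: complex^'d^'d)) \<le> cmod (trace (mat 1 :: complex^'d^'d))"
proof -
  have "cmod (trace (signed_perm_matrix \<sigma> s ** mat 1 :: complex^'d^'d)) \<le> (\<Sum>i::'d\<in>UNIV. 1)"
    unfolding trace_signed_perm_matrix_mult by (intro sum_norm_le) (simp add: mat_def norm_mult)
  then show ?thesis by (simp add: trace_I)
qed

lemma nc_det_0: "nc_det 0 M = mat 1" and nc_sdet_0: "nc_sdet 0 M = mat 1"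
  by (simp_all add: nc_det_def nc_sdet_def ordered_prod_def)

theorem theorem3:
  fixes P :: "'w measure"
    and n :: nat
    and A :: "nat \<Rightarrow> nat \<Rightarrow> real"
    and \<mu> :: "(complex^'d^'d) measure"
    and \<rho> :: "nat \<Rightarrow> nat \<Rightarrow> 'w \<Rightarrow> complex^'d^'d"
    and M :: "'w \<Rightarrow> nat \<Rightarrow> nat \<Rightarrow> complex^'d^'d"
    and d :: real
    and X X\<^sub>s X_Frob X_Frob\<^sub>s :: "'w \<Rightarrow> real"
  defines "d \<equiv> real CARD('d)"
    and "M \<equiv> (\<lambda>\<omega> i j. A i j *\<^sub>R \<rho> i j \<omega>)"
    and "X \<equiv> (\<lambda>\<omega>. (cmod (trace (nc_det n (M \<omega>))))\<^sup>2)"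
    and "X\<^sub>s \<equiv> (\<lambda>\<omega>. (cmod (trace (nc_sdet n (M \<omega>))))\<^sup>2)"
    and "X_Frob \<equiv> (\<lambda>\<omega>. frob_norm_sq (nc_det n (M \<omega>)))"
    and "X_Frob\<^sub>s \<equiv> (\<lambda>\<omega>. frob_norm_sq (nc_sdet n (M \<omega>)))"
  assumes "prob_space P"
    and "\<And>i j. i \<in> {1..n} \<Longrightarrow> j \<in> {1..n} \<Longrightarrow> A i j \<in> {0, 1}"
    and "is_haar_unitary \<mu> \<or> \<mu> = gaussian_matrix_measure"
    and "prob_space.indep_vars P (\<lambda>_. borel) (\<lambda>(i, j). \<rho> i j) ({1..n} \<times> {1..n})"
    and "\<And>i j. i \<in> {1..n} \<Longrightarrow> j \<in> {1..n} \<Longrightarrow> distr P borel (\<rho> i j) = \<mu>"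
  shows
    "1 / d ^ 4 * ((\<integral>\<omega>. (X \<omega>)\<^sup>2 \<partial>P) / (\<integral>\<omega>. X \<omega> \<partial>P)\<^sup>2)
       \<le> (\<integral>\<omega>. (X_Frob \<omega>)\<^sup>2 \<partial>P) / (\<integral>\<omega>. X_Frob \<omega> \<partial>P)\<^sup>2
     \<and> (\<integral>\<omega>. (X_Frob \<omega>)\<^sup>2 \<partial>P) / (\<integral>\<omega>. X_Frob \<omega> \<partial>P)\<^sup>2
       \<le> d ^ 4 * ((\<integral>\<omega>. (X \<omega>)\<^sup>2 \<partial>P) / (\<integral>\<omega>. X \<omega> \<partial>P)\<^sup>2)
     \<and> 1 / d ^ 4 * ((\<integral>\<omega>. (X\<^sub>s \<omega>)\<^sup>2 \<partial>P) / (\<integral>\<omega>. X\<^sub>s \<omega> \<partial>P)\<^sup>2)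
       \<le> (\<integral>\<omega>. (X_Frob\<^sub>s \<omega>)\<^sup>2 \<partial>P) / (\<integral>\<omega>. X_Frob\<^sub>s \<omega> \<partial>P)\<^sup>2
     \<and> (\<integral>\<omega>. (X_Frob\<^sub>s \<omega>)\<^sup>2 \<partial>P) / (\<integral>\<omega>. X_Frob\<^sub>s \<omega> \<partial>P)\<^sup>2
       \<le> d ^ 4 * ((\<integral>\<omega>. (X\<^sub>s \<omega>)\<^sup>2 \<partial>P) / (\<integral>\<omega>. X\<^sub>s \<omega> \<partial>P)\<^sup>2)"
proof -
  interpret prob_space P by fact
  have "\<rho> i j \<in> borel_measurable P" if "i \<in> {1..n}" "j \<in> {1..n}" for i j
    using assms(10) that unfolding indep_vars_def by fastforce
  then have M_meas: "(\<lambda>\<omega>. M \<omega> i j) \<in> borel_measurable P" if "i \<in> {1..n}" "j \<in> {1..n}" for i j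
    using that by (auto simp: M_def)
  have det: "(\<integral>\<^sup>+\<omega>. ennreal (cmod (trace (signed_perm_matrix \<sigma> s ** nc_det n (M \<omega>))) ^ p) \<partial>P)
      \<le> (\<integral>\<^sup>+\<omega>. ennreal (cmod (trace (nc_det n (M \<omega>))) ^ p) \<partial>P)"
    if "\<sigma> permutes UNIV" "p \<in> {2, 4}" for \<sigma> s p
  proof (cases "n = 0")
    case True
    then show ?thesis
      unfolding True nc_det_0
      by (intro nn_integral_mono ennreal_leI power_mono cmod_trace_signed_perm_matrix_le norm_ge_zero)
  next
    case False
    show ?thesis
      unfolding M_def
    \<comment> \<open>The first row alone suffices, because its factor always comes first.\<close>
    proof (rule trace_power_moment_mult_le[OF assms(7) signed_perm_invariant[OF assms(9) that(1)] assms(10,11),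
          where f = "nc_det n" and J = "{1}"])
      show "of_nat (card {1::nat}) * trace (signed_perm_matrix \<sigma> s ** nc_det n M')
        = (\<Sum>i\<in>{1}. trace (nc_det n (mult_row i (signed_perm_matrix \<sigma> s) M')))" for M'
        using False by (simp add: nc_det_mult_row)
    qed (use False that in \<open>auto intro: borel_measurable_nc_det nc_det_cong\<close>)
  qed
  have sdet: "(\<integral>\<^sup>+\<omega>. ennreal (cmod (trace (signed_perm_matrix \<sigma> s ** nc_sdet n (M \<omega>))) ^ p) \<partial>P)
      \<le> (\<integral>\<^sup>+\<omega>. ennreal (cmod (trace (nc_sdet n (M \<omega>))) ^ p) \<partial>P)"
    if "\<sigma> permutes UNIV" "p \<in> {2, 4}" for \<sigma> s p
  proof (cases "n = 0")
    case True
    then show ?thesis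
      unfolding True nc_sdet_0
      by (intro nn_integral_mono ennreal_leI power_mono cmod_trace_signed_perm_matrix_le norm_ge_zero)
  next
    case False
    show ?thesis
      unfolding M_def
    \<comment> \<open>Here no row always comes first, so the average runs over all rows.\<close>
    proof (rule trace_power_moment_mult_le[OF assms(7) signed_perm_invariant[OF assms(9) that(1)] assms(10,11),
          where f = "nc_sdet n" and J = "{1..n}"])
      show "of_nat (card {1..n}) * trace (signed_perm_matrix \<sigma> s ** nc_sdet n M')
        = (\<Sum>i\<in>{1..n}. trace (nc_sdet n (mult_row i (signed_perm_matrix \<sigma> s) M')))" for M'
        by (simp only: sum_trace_nc_sdet_mult_row card_atLeastAtMost diff_Suc_1)
    qed (use False that in \<open>auto intro: borel_measurable_nc_sdet nc_sdet_cong\<close>)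
  qed
  show ?thesis
    using trace_frob_moment_ratio_bounds[OF borel_measurable_nc_det[OF M_meas] det]
      trace_frob_moment_ratio_bounds[OF borel_measurable_nc_sdet[OF M_meas] sdet]
    unfolding X_def X\<^sub>s_def X_Frob_def X_Frob\<^sub>s_def d_def by blast
qed

end
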